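(* Let $(M,\le_m)$ and $(L,\le_l)$ be partially ordered sets, and let $\boxminus^{\star}: L\times L\to L$, $\boxplus^{\star}: 2^L\to L$ and $\circledcirc^{\star}: L\to L$ be operations satisfying the following axioms: (A*1) for every $S\subseteq M$ there is $\breve S\subseteq S$ such that for every $s\in S$ there is $\breve s\in\breve S$ with $\breve s\ge_m s$, and no two elements $\breve s,\breve s'\in\breve S$ satisfy $\breve s<_m\breve s'$; (A*2) for all $L'\subseteq L$ and all $x\in L'$ we have $x\ge_l\boxplus^{\star}(L')$, and for all $L'\subseteq L''\subseteq L$ we have $\boxplus^{\star}(L')\ge_l\boxplus^{\star}(L'')$; (A*3) for all $l,l'\in L$: $\boxminus^{\star}(\circledcirc^{\star}(l),l)=l$, and $l\ge_l l'$ implies $\circledcirc^{\star}(l)\ge_l\circledcirc^{\star}(l')$; (A*4) for all $l,l'\in L$ with $l\ge_l l'$ there exists $l''\in L$ with $\boxminus^{\star}(l'',l')=l$ and $\circledcirc^{\star}(l')\ge_l l''$. Suppose moreover that every strictly increasing chain in $(M,\le_m)$ has length at most $D$, for some integer $D\ge0$. Then for every map $\psi:M\to L$ there exist an integer $n$ with $0\le n\le D$ and monotonic maps $\varphi_1,\dots,\varphi_{n+1}:M\to L$ such that for all $x\in M$, $$\psi(x)=\boxminus^{\star}\Big(\dots\boxminus^{\star}\big(\boxminus^{\star}(\varphi_{n+1}(x),\varphi_n(x)),\varphi_{n-1}(x)\big)\dots,\varphi_1(x)\Big),$$ so that the operation $\boxminus^{\star}$ occurs at most $D$ times in the representation.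
   Context: A map $\varphi:(M,\le_m)\to(L,\le_l)$ is monotonic if $m\le_m m'$ implies $\varphi(m)\le_l\varphi(m')$. The length of a strictly increasing chain $x_0<_m x_1<_m\dots<_m x_r$ is $r$. $2^L$ denotes the set of all subsets of $L$. Operations on $L$ are applied to maps $M\to L$ pointwise. *)

theory Defs
  imports Main
begin

end

theory Submission
  imports Defs
begin

text \<open>
  Suppose \<open>\<psi>\<close> is monotonic on an up-closed set \<open>U\<close>. Take \<open>\<phi> = \<psi>\<close> on \<open>U\<close> and
  \<open>\<phi> x = boxplus {\<psi> y | y \<ge> x}\<close> outside; this is monotonic. Write \<open>\<psi> = boxminus \<psi>' \<phi>\<close> with
  \<open>\<psi>' = circ \<circ> \<phi>\<close> on \<open>U\<close> and \<open>\<psi>' \<le> circ \<circ> \<phi>\<close> outside. Then \<open>\<psi>' x \<le> \<psi>' y\<close> whenever \<open>x \<le> y\<close>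
  and \<open>y \<in> U\<close>, so \<open>\<psi>'\<close> is monotonic on \<open>U\<close> together with the maximal elements of its complement.
  Starting from the set of maximal elements of the whole order, at most \<open>D\<close> such steps
  exhaust it, and what is left is monotonic.
\<close>

lemma split_off_mono:
  fixes boxminus :: "'l::order \<Rightarrow> 'l \<Rightarrow> 'l"
    and boxplus :: "'l set \<Rightarrow> 'l"
    and circ :: "'l \<Rightarrow> 'l"
    and \<psi> :: "'m::order \<Rightarrow> 'l"
  assumes lower: "\<And>L' x. x \<in> L' \<Longrightarrow> boxplus L' \<le> x"
    and anti: "\<And>L' L''. L' \<subseteq> L'' \<Longrightarrow> boxplus L'' \<le> boxplus L'"
    and circ_eq: "\<And>l. boxminus (circ l) l = l"
    and circ_mono: "\<And>l l'. l' \<le> l \<Longrightarrow> circ l' \<le> circ l"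
    and solve: "\<And>l l'. l' \<le> l \<Longrightarrow> \<exists>l''. boxminus l'' l' = l \<and> l'' \<le> circ l'"
    and up: "\<And>x y. x \<in> U \<Longrightarrow> x \<le> y \<Longrightarrow> y \<in> U"
    and mono: "mono_on U \<psi>"
  obtains \<phi> \<psi>' where "mono \<phi>" "\<And>x. \<psi> x = boxminus (\<psi>' x) (\<phi> x)"
    "\<And>x y. x \<le> y \<Longrightarrow> y \<in> U \<Longrightarrow> \<psi>' x \<le> \<psi>' y"
proof -
  define \<phi> where "\<phi> x = (if x \<in> U then \<psi> x else boxplus (\<psi> ` {x..}))" for x
  have \<phi>_mono: "\<phi> x \<le> \<phi> y" if "x \<le> y" for x y
  proof (cases "x \<in> U")
    case True
    with that up mono show ?thesis by (auto simp: \<phi>_def dest: mono_onD)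
  next
    case x: False
    show ?thesis
    proof (cases "y \<in> U")
      case True
      \<comment> \<open>Here \<open>\<psi> y\<close> is one of the values collected under
        \<open>boxplus\<close>, because \<open>x \<le> y\<close>.\<close>
      with x that show ?thesis by (auto simp: \<phi>_def intro: lower)
    next
      case False
      have "\<psi> ` {y..} \<subseteq> \<psi> ` {x..}" using that by auto
      with x False show ?thesis by (simp add: \<phi>_def anti)
    qed
  qed
  \<comment> \<open>Outside \<open>U\<close> this holds because \<open>x\<close> itself lies in
    \<open>{x..}\<close>. The inequality is what \<open>solve\<close> requires.\<close>
  have "\<phi> x \<le> \<psi> x" for x by (auto simp: \<phi>_def intro: lower)
  then have "\<exists>l. boxminus l (\<phi> x) = \<psi> x \<and> l \<le> circ (\<phi> x)" for x by (rule solve)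
  then obtain g where g: "\<And>x. boxminus (g x) (\<phi> x) = \<psi> x" "\<And>x. g x \<le> circ (\<phi> x)" by metis
  \<comment> \<open>On \<open>U\<close>, where \<open>\<phi> x = \<psi> x\<close>,
    \<open>circ_eq\<close> makes \<open>circ (\<phi> x)\<close> an exact solution. It attains the
    bound that \<open>g\<close> merely respects, so a value on \<open>U\<close> dominates all values
    below it.\<close>
  define \<psi>' where "\<psi>' x = (if x \<in> U then circ (\<phi> x) else g x)" for x
  show thesis
  proof (rule that)
    show "mono \<phi>" by (simp add: mono_def \<phi>_mono)
    show "\<psi> x = boxminus (\<psi>' x) (\<phi> x)" for x
      by (simp add: \<psi>'_def g circ_eq) (simp add: \<phi>_def)
    show "\<psi>' x \<le> \<psi>' y" if "x \<le> y" "y \<in> U" for x y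
    proof -
      have "\<psi>' x \<le> circ (\<phi> x)" by (simp add: \<psi>'_def g)
      also have "\<dots> \<le> circ (\<phi> y)" using that(1) by (intro circ_mono \<phi>_mono)
      finally show ?thesis using that(2) by (simp add: \<psi>'_def)
    qed
  qed
qed

lemma chain_extend:
  fixes c :: "nat \<Rightarrow> 'm::order"
  assumes "\<And>i. i < r \<Longrightarrow> c i < c (Suc i)" "c r < y" "i < Suc r"
  shows "(c(Suc r := y)) i < (c(Suc r := y)) (Suc i)"
  using assms by (cases "i = r") auto

text \<open>Induction on \<open>n\<close>, a strict bound on the length of chains avoiding
  \<open>U\<close>: each round of splitting enlarges \<open>U\<close> enough to lower the bound by
  one and costs one \<open>boxminus\<close>.\<close>

lemma mono_representation:
  fixes boxminus :: "'l::order \<Rightarrow> 'l \<Rightarrow> 'l"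
    and boxplus :: "'l set \<Rightarrow> 'l"
    and circ :: "'l \<Rightarrow> 'l"
    and \<psi> :: "'m::order \<Rightarrow> 'l"
  assumes ops: "\<And>L' x. x \<in> L' \<Longrightarrow> boxplus L' \<le> x"
    "\<And>L' L''. L' \<subseteq> L'' \<Longrightarrow> boxplus L'' \<le> boxplus L'"
    "\<And>l. boxminus (circ l) l = l"
    "\<And>l l'. l' \<le> l \<Longrightarrow> circ l' \<le> circ l"
    "\<And>l l'. l' \<le> l \<Longrightarrow> \<exists>l''. boxminus l'' l' = l \<and> l'' \<le> circ l'"
    and up: "\<And>x y. x \<in> U \<Longrightarrow> x \<le> y \<Longrightarrow> y \<in> U"
    and mono: "mono_on U \<psi>"
    and chains: "\<And>r c. (\<And>i. i < r \<Longrightarrow> c i < c (Suc i)) \<Longrightarrow> (\<And>i. i \<le> r \<Longrightarrow> c i \<notin> U) \<Longrightarrow> r < n"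
  shows "\<exists>\<phi>::nat \<Rightarrow> 'm \<Rightarrow> 'l. (\<forall>i\<in>{1..n+1}. mono (\<phi> i)) \<and>
    (\<forall>x. \<psi> x = foldl boxminus (\<phi> (n+1) x) (map (\<lambda>i. \<phi> i x) (rev [1..<n+1])))"
  using up mono chains
proof (induction n arbitrary: U \<psi>)
  case 0
  \<comment> \<open>A single point outside \<open>U\<close> would be a chain of length 0, which is
    not below 0.\<close>
  have "x \<in> U" for x using "0.prems"(3)[of 0 "\<lambda>_. x"] by auto
  then have "mono \<psi>" using "0.prems"(2) by (auto simp: mono_on_def mono_def)
  then show ?case by (intro exI[of _ "\<lambda>_. \<psi>"]) simp
next
  case (Suc n)
  obtain \<phi>\<^sub>1 \<psi>' where \<phi>\<^sub>1: "mono \<phi>\<^sub>1" "\<And>x. \<psi> x = boxminus (\<psi>' x) (\<phi>\<^sub>1 x)"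
    and \<psi>': "\<And>x y. x \<le> y \<Longrightarrow> y \<in> U \<Longrightarrow> \<psi>' x \<le> \<psi>' y"
    by (rule split_off_mono[OF ops Suc.prems(1,2)]) blast+
  define V where "V = U \<union> {x. \<forall>y>x. y \<in> U}"
  have "\<exists>\<phi>::nat \<Rightarrow> 'm \<Rightarrow> 'l. (\<forall>i\<in>{1..n+1}. mono (\<phi> i)) \<and>
    (\<forall>x. \<psi>' x = foldl boxminus (\<phi> (n+1) x) (map (\<lambda>i. \<phi> i x) (rev [1..<n+1])))"
  proof (rule Suc.IH)
    show "y \<in> V" if "x \<in> V" "x \<le> y" for x y
      using that Suc.prems(1) by (auto simp: V_def order_le_less)
    show "mono_on V \<psi>'"
    proof (rule mono_onI)
      fix x y assume xy: "x \<in> V" "y \<in> V" "x \<le> y"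
      show "\<psi>' x \<le> \<psi>' y"
      proof (cases "y \<in> U")
        case True
        with xy \<psi>' show ?thesis by blast
      next
        case False
        \<comment> \<open>If \<open>x < y\<close>, either way for \<open>x\<close> to be in
          \<open>V\<close> would force \<open>y\<close> into \<open>U\<close>: up-closure, or all
          elements above \<open>x\<close> being in \<open>U\<close>.\<close>
        with xy Suc.prems(1) have "x = y" by (auto simp: V_def order_le_less)
        then show ?thesis by simp
      qed
    qed
    show "r < n" if c: "\<And>i. i < r \<Longrightarrow> c i < c (Suc i)" "\<And>i. i \<le> r \<Longrightarrow> c i \<notin> V" for r c
    proof -
      \<comment> \<open>The top of a chain avoiding \<open>V\<close> is not maximal outside
        \<open>U\<close>, so the chain can be prolonged by one element while still avoiding
        \<open>U\<close>.\<close>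
      obtain y where y: "c r < y" "y \<notin> U" using c(2)[of r] by (auto simp: V_def)
      have "Suc r < Suc n"
      proof (rule Suc.prems(3))
        show "(c(Suc r := y)) i < (c(Suc r := y)) (Suc i)" if "i < Suc r" for i
          using c(1) y(1) that by (rule chain_extend)
        show "(c(Suc r := y)) i \<notin> U" if "i \<le> Suc r" for i
          using that y(2) c(2)[of i] by (auto simp: V_def)
      qed
      then show ?thesis by simp
    qed
  qed
  then obtain \<phi> where \<phi>: "\<And>i. i \<in> {1..n+1} \<Longrightarrow> mono (\<phi> i)"
    and rep: "\<And>x. \<psi>' x = foldl boxminus (\<phi> (n+1) x) (map (\<lambda>i. \<phi> i x) (rev [1..<n+1]))"
    by blast
  \<comment> \<open>The map just split off is the right operand of the outermost
    \<open>boxminus\<close>, hence last in the reversed list: it gets index 1 and the others shift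
    up.\<close>
  define \<chi> where "\<chi> i = (if i = 1 then \<phi>\<^sub>1 else \<phi> (i - 1))" for i
  have "mono (\<chi> i)" if "i \<in> {1..Suc n + 1}" for i
    using that \<phi>\<^sub>1(1) by (auto simp: \<chi>_def intro!: \<phi>)
  moreover have "\<psi> x = foldl boxminus (\<chi> (Suc n + 1) x) (map (\<lambda>i. \<chi> i x) (rev [1..<Suc n + 1]))"
    for x
  proof -
    have "[1..<Suc n + 1] = 1 # map Suc [1..<n+1]"
      by (simp add: upt_conv_Cons map_Suc_upt del: upt_Suc)
    then have "map (\<lambda>i. \<chi> i x) (rev [1..<Suc n + 1]) =
        map (\<lambda>i. \<chi> (Suc i) x) (rev [1..<n+1]) @ [\<phi>\<^sub>1 x]"
      by (simp only:) (simp add: rev_map comp_def \<chi>_def del: upt_Suc)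
    also have "map (\<lambda>i. \<chi> (Suc i) x) (rev [1..<n+1]) = map (\<lambda>i. \<phi> i x) (rev [1..<n+1])"
      by (rule map_cong) (auto simp: \<chi>_def)
    finally have "map (\<lambda>i. \<chi> i x) (rev [1..<Suc n + 1]) =
        map (\<lambda>i. \<phi> i x) (rev [1..<n+1]) @ [\<phi>\<^sub>1 x]" .
    moreover have "\<chi> (Suc n + 1) = \<phi> (n + 1)" by (simp add: \<chi>_def)
    ultimately show ?thesis
      by (simp only: \<phi>\<^sub>1(2) rep foldl_append foldl.simps)
  qed
  ultimately show ?case by blast
qed

theorem mainTheorem3:
  fixes boxminus :: "'l::order \<Rightarrow> 'l \<Rightarrow> 'l"
    and boxplus :: "'l set \<Rightarrow> 'l"
    and circ :: "'l \<Rightarrow> 'l"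
    and D :: nat
    and \<psi> :: "'m::order \<Rightarrow> 'l"
  assumes A1: "\<forall>S::'m set. \<exists>T\<subseteq>S. (\<forall>s\<in>S. \<exists>t\<in>T. t \<ge> s) \<and> \<not> (\<exists>t\<in>T. \<exists>t'\<in>T. t < t')"
    and A2: "\<forall>L'. \<forall>x\<in>L'. x \<ge> boxplus L'"
            "\<forall>L' L''. L' \<subseteq> L'' \<longrightarrow> boxplus L' \<ge> boxplus L''"
    and A3: "\<forall>l. boxminus (circ l) l = l"
            "\<forall>l l'. l \<ge> l' \<longrightarrow> circ l \<ge> circ l'"
    and A4: "\<forall>l l'. l \<ge> l' \<longrightarrow> (\<exists>l''. boxminus l'' l' = l \<and> circ l' \<ge> l'')"
    and chains: "\<forall>(r::nat) (c::nat \<Rightarrow> 'm). (\<forall>i<r. c i < c (Suc i)) \<longrightarrow> r \<le> D"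
  shows "\<exists>n\<le>D. \<exists>\<phi>::nat \<Rightarrow> 'm \<Rightarrow> 'l.
           (\<forall>i\<in>{1..n+1}. mono (\<phi> i)) \<and>
           (\<forall>x. \<psi> x = foldl boxminus (\<phi> (n+1) x) (map (\<lambda>i. \<phi> i x) (rev [1..<n+1])))"
proof -
  define U where "U = {x::'m. \<forall>y. \<not> x < y}"
  have "\<exists>\<phi>::nat \<Rightarrow> 'm \<Rightarrow> 'l. (\<forall>i\<in>{1..D+1}. mono (\<phi> i)) \<and>
    (\<forall>x. \<psi> x = foldl boxminus (\<phi> (D+1) x) (map (\<lambda>i. \<phi> i x) (rev [1..<D+1])))"
  proof (rule mono_representation[where boxplus = boxplus and circ = circ and U = U])
    show "y \<in> U" if "x \<in> U" "x \<le> y" for x y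
      using that by (auto simp: U_def order_le_less)
    \<comment> \<open>Distinct maximal elements are incomparable, so any map is monotonic on
      them.\<close>
    show "mono_on U \<psi>" by (auto simp: mono_on_def U_def order_le_less)
    show "r < D" if c: "\<And>i. i < r \<Longrightarrow> c i < c (Suc i)" "\<And>i. i \<le> r \<Longrightarrow> c i \<notin> U" for r c
    proof -
      \<comment> \<open>A chain avoiding the maximal elements can be prolonged at its top, which
        turns the bound \<open>D\<close> into a strict one.\<close>
      obtain y where "c r < y" using c(2)[of r] by (auto simp: U_def)
      with c(1) have "\<forall>i<Suc r. (c(Suc r := y)) i < (c(Suc r := y)) (Suc i)"
        by (blast intro: chain_extend)
      with chains have "Suc r \<le> D" by blast
      then show ?thesis by simp
    qed
  qed (use A2 A3 A4 in auto)
  \<comment> \<open>The witness for \<open>n\<close> is \<open>D\<close> itself.\<close>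
  then show ?thesis by blast
qed

end
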